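(* Let $q\ge 2$, $n\ge1$, and let $C=(C_1,\ldots,C_r)$ be a perfect $r$-coloring of the $q$-ary $n$-dimensional hypercube with parameter matrix $S=(s_{ij})_{i,j=1}^r$. Let $\alpha\in\mathbb{F}_q^n$, $I\subseteq\{1,\ldots,n\}$, $\overline{I}=\{1,\ldots,n\}\setminus I$, let $E$ be the $r\times r$ identity matrix and put $h(S)=\frac{(q-1)nE-S}{q}$. Then $$g^{\overline{I},\alpha}_C(x,y)\,(x+(q-1)y)^{h(S)-|\overline{I}|E} = g^{I,\alpha}_C(x',y')\,(x'+(q-1)y')^{h(S)-|I|E},$$ where $x'=x+(q-2)y$, $y'=-y$, the local weight enumerators $g_C$ are row vectors, and $z^{A}$ for a matrix $A$ denotes the matrix function (multiplied on the right).
   Context: $\mathbb{F}_q=\{0,\ldots,q-1\}$ is the group of integers modulo $q$; the $q$-ary $n$-dimensional hypercube is the graph on $\mathbb{F}_q^n$ where two vertices are adjacent iff they differ in exactly one coordinate. $s(\beta)$ denotes the set of nonzero coordinates of $\beta$; $W_j(\alpha)$ is the set of vertices at Hamming distance exactly $j$ from $\alpha$; for $I\subseteq\{1,\ldots,n\}$, the face is $\Gamma_I(\alpha)=\{\beta:\beta_i=\alpha_i\ \forall i\notin I\}$. A partition $C=(C_1,\ldots,C_r)$ of $\mathbb{F}_q^n$ is a perfect $r$-coloring with parameter matrix $S=(s_{ij})$ if for all $i,j$ and every vertex $\alpha\in C_i$, the number of vertices of $C_j$ adjacent to $\alpha$ equals $s_{ij}$. For a color $C_i$, its $(I,\alpha)$-local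 weight enumerator is $g^{I,\alpha}_{C_i}(x,y)=\sum_{j=0}^{|I|} |C_i\cap W_j(\alpha)\cap\Gamma_I(\alpha)|\, y^j x^{|I|-j}$, and the $(I,\alpha)$-local weight enumerator of $C$ is the row vector $g^{I,\alpha}_C(x,y)=(g^{I,\alpha}_{C_1}(x,y),\ldots,g^{I,\alpha}_{C_r}(x,y))$. For an $r\times r$ matrix $A$ diagonalizable as $A=T\,\mathrm{diag}(a_1,\ldots,a_r)\,T^{-1}$ (the matrices $h(S)-kE$ here are of this form, with integer $a_i$), $z^{A}$ denotes the matrix function $T\,\mathrm{diag}(z^{a_1},\ldots,z^{a_r})\,T^{-1}$, with entries rational functions in $x,y$. *)

theory Defs
  imports
    "Jordan_Normal_Form.Matrix"
    "HOL-Computational_Algebra.Polynomial_Factorial"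
    "HOL-Library.Disjoint_Sets"
    "HOL-Library.FuncSet"
    Complex_Main
begin

section \<open>Perfect colorings of the hypercube\<close>

text \<open>Vertices are extensional functions, so that equal vertices are equal as functions.\<close>

definition cube :: "nat \<Rightarrow> nat \<Rightarrow> (nat \<Rightarrow> nat) set" where
  "cube q n = {1..n} \<rightarrow>\<^sub>E {0..<q}"

definition hamming_dist :: "nat \<Rightarrow> (nat \<Rightarrow> nat) \<Rightarrow> (nat \<Rightarrow> nat) \<Rightarrow> nat" where
  "hamming_dist n \<alpha> \<beta> = card {i \<in> {1..n}. \<alpha> i \<noteq> \<beta> i}"

definition cube_adj :: "nat \<Rightarrow> (nat \<Rightarrow> nat) \<Rightarrow> (nat \<Rightarrow> nat) \<Rightarrow> bool" where
  "cube_adj n \<alpha> \<beta> \<longleftrightarrow> (\<exists>!i. i \<in> {1..n} \<and> \<alpha> i \<noteq> \<beta> i)"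

definition sphere_at :: "nat \<Rightarrow> nat \<Rightarrow> nat \<Rightarrow> (nat \<Rightarrow> nat) \<Rightarrow> (nat \<Rightarrow> nat) set" where
  "sphere_at q n j \<alpha> = {\<beta> \<in> cube q n. hamming_dist n \<alpha> \<beta> = j}"

definition face :: "nat \<Rightarrow> nat \<Rightarrow> nat set \<Rightarrow> (nat \<Rightarrow> nat) \<Rightarrow> (nat \<Rightarrow> nat) set" where
  "face q n I \<alpha> = {\<beta> \<in> cube q n. \<forall>i \<in> {1..n} - I. \<beta> i = \<alpha> i}"

text \<open>The \<open>r\<close> colors are numbered \<open>0, \<dots>, r - 1\<close>, as are rows and columns of matrices.
  As usual for partitions, the classes are nonempty; otherwise the rows of \<open>S\<close> that belong to empty
  classes would be arbitrary.\<close>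

definition perfect_coloring ::
  "nat \<Rightarrow> nat \<Rightarrow> nat \<Rightarrow> (nat \<Rightarrow> (nat \<Rightarrow> nat) set) \<Rightarrow> nat mat \<Rightarrow> bool" where
  "perfect_coloring q n r C S \<longleftrightarrow>
     (\<forall>i<r. C i \<noteq> {}) \<and> disjoint_family_on C {..<r} \<and> (\<Union>i<r. C i) = cube q n \<and>
     S \<in> carrier_mat r r \<and>
     (\<forall>i<r. \<forall>j<r. \<forall>\<alpha>\<in>C i. card {\<beta> \<in> C j. cube_adj n \<alpha> \<beta>} = S $$ (i, j))"

text \<open>The enumerator as a function of two elements of a commutative ring: applied to the
  indeterminates it is the polynomial, applied to other elements it is the result of substituting
  them.\<close>

definition local_weight_enum ::
  "nat \<Rightarrow> nat \<Rightarrow> (nat \<Rightarrow> nat) set \<Rightarrow> nat set \<Rightarrow> (nat \<Rightarrow> nat) \<Rightarrow> 'a \<Rightarrow> 'a \<Rightarrow> 'a::comm_ring_1" where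
  "local_weight_enum q n B I \<alpha> x y =
     (\<Sum>j=0..card I. of_nat (card (B \<inter> sphere_at q n j \<alpha> \<inter> face q n I \<alpha>)) * y ^ j * x ^ (card I - j))"

definition local_weight_enum_row ::
  "nat \<Rightarrow> nat \<Rightarrow> nat \<Rightarrow> (nat \<Rightarrow> (nat \<Rightarrow> nat) set) \<Rightarrow> nat set \<Rightarrow> (nat \<Rightarrow> nat) \<Rightarrow> 'a \<Rightarrow> 'a \<Rightarrow>
     'a::comm_ring_1 mat" where
  "local_weight_enum_row q n r C I \<alpha> x y = mat 1 r (\<lambda>(_, j). local_weight_enum q n (C j) I \<alpha> x y)"

definition h_mat :: "nat \<Rightarrow> nat \<Rightarrow> nat mat \<Rightarrow> complex mat" where
  "h_mat q n S = (1 / of_nat q) \<cdot>\<^sub>m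
     (((of_nat q - 1) * of_nat n) \<cdot>\<^sub>m 1\<^sub>m (dim_row S) - map_mat of_nat S)"

section \<open>Matrix powers over the field of rational functions in two variables\<close>

type_synonym ratfun2 = "complex poly poly fract"

definition rf_const :: "complex \<Rightarrow> ratfun2" where
  "rf_const c = to_fract [:[:c:]:]"

definition rf_X :: ratfun2 where
  "rf_X = to_fract [:[:0, 1:]:]"

definition rf_Y :: ratfun2 where
  "rf_Y = to_fract [:0, 1:]"

text \<open>\<open>z\<^sup>A\<close> for a matrix \<open>A = T diag(a\<^sub>0, \<dots>) T'\<close> with \<open>T'\<close> inverse to \<open>T\<close> and integers \<open>a\<^sub>i\<close>. The
  relation determines its last argument (\<open>is_mat_powi_unique\<close> below), so the definite description is
  meaningful for every such \<open>A\<close>; for other matrices it is unspecified.\<close>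

definition is_mat_powi :: "ratfun2 \<Rightarrow> complex mat \<Rightarrow> ratfun2 mat \<Rightarrow> bool" where
  "is_mat_powi z A M \<longleftrightarrow>
     (\<exists>T T' a. similar_mat_wit A (mat_diag (dim_row A) (\<lambda>i. of_int (a i))) T T' \<and>
        M = map_mat rf_const T * mat_diag (dim_row A) (\<lambda>i. z powi a i) * map_mat rf_const T')"

definition mat_powi :: "ratfun2 \<Rightarrow> complex mat \<Rightarrow> ratfun2 mat" where
  "mat_powi z A = (THE M. is_mat_powi z A M)"

interpretation rf_const_hom: inj_comm_ring_hom rf_const
proof
  show "rf_const (a + b) = rf_const a + rf_const b" for a b
    by (simp add: rf_const_def flip: to_fract_add)
  show "rf_const (a * b) = rf_const a * rf_const b" for a b
    by (simp add: rf_const_def flip: to_fract_mult)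
  show "rf_const 0 = 0" "rf_const 1 = 1"
    by (simp_all add: rf_const_def flip: one_pCons)
  show "a = 0" if "rf_const a = 0" for a
    using that by (simp add: rf_const_def)
qed

lemma is_mat_powi_unique:
  assumes "is_mat_powi z A M" "is_mat_powi z A N"
  shows "M = N"
proof -
  define r where "r = dim_row A"
  obtain P P' a where
    sP: "similar_mat_wit A (mat_diag r (\<lambda>i. of_int (a i))) P P'" and
    M: "M = map_mat rf_const P * mat_diag r (\<lambda>i. z powi a i) * map_mat rf_const P'"
    using assms(1) unfolding is_mat_powi_def r_def by blast
  obtain Q Q' b where
    sQ: "similar_mat_wit A (mat_diag r (\<lambda>i. of_int (b i))) Q Q'" and
    N: "N = map_mat rf_const Q * mat_diag r (\<lambda>i. z powi b i) * map_mat rf_const Q'"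
    using assms(2) unfolding is_mat_powi_def r_def by blast
  define D F :: "complex mat" where
    "D = mat_diag r (\<lambda>i. of_int (a i))" and "F = mat_diag r (\<lambda>i. of_int (b i))"
  define U V where "U = mat_diag r (\<lambda>i. z powi a i)" and "V = mat_diag r (\<lambda>i. z powi b i)"
  note P = similar_mat_witD[OF r_def sP, folded D_def]
  note Q = similar_mat_witD[OF r_def sQ, folded F_def]
  have UV: "U \<in> carrier_mat r r" "V \<in> carrier_mat r r"
    by (simp_all add: U_def V_def mat_diag_def)
  define R where "R = Q' * P"
  have R: "R \<in> carrier_mat r r" using P Q by (simp add: R_def)
  have "R * D = Q' * (P * D * P') * P"
  proof -
    have "Q' * (P * D * P') * P = Q' * (P * D * (P' * P))"
      using P(5-7) Q(5-7) by (simp add: assoc_mult_mat[of _ r r _ r _ r])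
    thus ?thesis using P Q by (simp add: R_def assoc_mult_mat[of _ r r _ r _ r])
  qed
  also have "\<dots> = Q' * (Q * F * Q') * P" using P(3) Q(3) by simp
  also have "\<dots> = (Q' * Q) * F * R"
    using P(5-7) Q(5-7) by (simp add: R_def assoc_mult_mat[of _ r r _ r _ r])
  also have "\<dots> = F * R" using Q(2,5) by simp
  finally have RD: "R * D = F * R" .
  have ent: "R $$ (i, j) * of_int (a j) = of_int (b i) * R $$ (i, j)" if "i < r" "j < r" for i j
  proof -
    have "(R * D) $$ (i, j) = (F * R) $$ (i, j)" using RD by simp
    thus ?thesis using that
      by (simp add: D_def F_def mat_diag_mult_left[OF R] mat_diag_mult_right[OF R])
  qed
  let ?e = "map_mat rf_const"
  have eR: "?e R \<in> carrier_mat r r" using R by simp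
  have RU: "?e R * U = V * ?e R"
  proof (rule eq_matI)
    fix i j assume "i < dim_row (V * ?e R)" "j < dim_col (V * ?e R)"
    hence ij: "i < r" "j < r" using R UV by auto
    have "R $$ (i, j) = 0 \<or> a j = b i" using ent[OF ij] by auto
    thus "(?e R * U) $$ (i, j) = (V * ?e R) $$ (i, j)"
      using ij R by (auto simp: U_def V_def mat_diag_mult_left[OF eR] mat_diag_mult_right[OF eR])
  qed (use R UV in auto)
  have hm: "?e (X * Y) = ?e X * ?e Y" if "X \<in> carrier_mat r r" "Y \<in> carrier_mat r r" for X Y
    using rf_const_hom.mat_hom_mult that by blast
  have "Q * R = (Q * Q') * P" unfolding R_def using P(6) Q(6,7) by (metis assoc_mult_mat)
  hence QR: "Q * R = P" using P Q by simp
  have "R * P' = Q' * (P * P')" unfolding R_def using P(6,7) Q(7) by (metis assoc_mult_mat)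
  hence RP: "R * P' = Q'" using P Q by simp
  have car: "?e P' \<in> carrier_mat r r" "?e Q \<in> carrier_mat r r" using P Q by auto
  have "M = ?e Q * ?e R * U * ?e P'"
    using hm[OF Q(6) R] QR by (simp add: M U_def)
  also have "\<dots> = ?e Q * (?e R * U) * ?e P'"
    using car eR UV by (simp add: assoc_mult_mat[of _ r r _ r _ r])
  also have "\<dots> = ?e Q * V * (?e R * ?e P')"
    unfolding RU using car eR UV by (simp add: assoc_mult_mat[of _ r r _ r _ r])
  also have "\<dots> = N"
    using hm[OF R P(7)] RP by (simp add: N V_def)
  finally show ?thesis .
qed

lemma mat_powi_eqI: "is_mat_powi z A M \<Longrightarrow> mat_powi z A = M"
  unfolding mat_powi_def using is_mat_powi_unique by blast

end

theory Submission
  imports Defs "Jordan_Normal_Form.Determinant"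
begin

text \<open>On functions on the cube, averaging over the \<open>i\<close>-th coordinate is a projection \<open>p\<^sub>i\<close>, and these projections
  commute. For \<open>T \<subseteq> {1..n}\<close> let \<open>E\<^sub>T\<close> be the product of the \<open>1 - p\<^sub>i\<close> with \<open>i \<in> T\<close> and the \<open>p\<^sub>i\<close> with
  \<open>i \<notin> T\<close>. The \<open>E\<^sub>T\<close> sum to the identity and the adjacency operator acts on the range of \<open>E\<^sub>T\<close> as
  \<open>(q - 1) n - q |T|\<close>. Summing a row of \<open>E\<^sub>T\<close> over the color classes gives a row vector \<open>l\<^sub>T\<close>, which is
  therefore a left eigenvector of \<open>h(S)\<close> with eigenvalue \<open>|T|\<close>. These vectors separate points, so
  \<open>h(S)\<close> is diagonalizable with integer eigenvalues, and \<open>l\<^sub>T z\<^bsup>h(S)\<^esup> = z\<^bsup>|T|\<^esup> l\<^sub>T\<close>.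

  The weight \<open>x\<close> on equal and \<open>y\<close> on different coordinates is \<open>z p\<^sub>i + w (1 - p\<^sub>i)\<close> with \<open>z = x + (q - 1) y\<close>
  and \<open>w = x - y\<close>. Hence the enumerator of the face \<open>J\<close> is the sum of the \<open>w\<^bsup>|T \<inter> J|\<^esup> z\<^bsup>|J - T|\<^esup> l\<^sub>T\<close>, and
  multiplying it by \<open>z\<^bsup>h(S) - |J|\<^esup>\<close> gives the sum of the \<open>w\<^bsup>|T \<inter> J|\<^esup> z\<^bsup>|T - J|\<^esup> l\<^sub>T\<close>. Complementing \<open>J\<close>
  swaps the two exponents, and the substitution \<open>x', y'\<close> swaps \<open>z\<close> and \<open>w\<close>.\<close>

section \<open>Product kernels on the cube and the projections \<open>char_proj\<close>\<close>

text \<open>The matrix entry at \<open>(a, b)\<close> of \<open>s p + t (1 - p)\<close>, where \<open>p\<close> is averaging over \<open>{0..<q}\<close>.\<close>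

definition site :: "nat \<Rightarrow> 'a::field \<Rightarrow> 'a \<Rightarrow> nat \<Rightarrow> nat \<Rightarrow> 'a" where
  "site q s t a b = s / of_nat q + t * (of_bool (a = b) - 1 / of_nat q)"

text \<open>Kernel of the tensor product over \<open>i\<close> of the operators
  \<open>s i * p\<^sub>i + t i * (1 - p\<^sub>i)\<close>.\<close>

definition coord_kernel ::
  "nat \<Rightarrow> nat \<Rightarrow> (nat \<Rightarrow> 'a::field) \<Rightarrow> (nat \<Rightarrow> 'a) \<Rightarrow> (nat \<Rightarrow> nat) \<Rightarrow> (nat \<Rightarrow> nat) \<Rightarrow> 'a" where
  "coord_kernel q n s t u v = (\<Prod>i=1..n. site q (s i) (t i) (u i) (v i))"

text \<open>The projection \<open>E\<^sub>T\<close> of the overview. Over the complex numbers its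
  range is spanned by the characters whose support is exactly \<open>T\<close>. Being built from
  averages, it needs no roots of unity and makes sense over \<open>complex\<close> and
  \<open>ratfun2\<close> alike.\<close>

definition char_proj :: "nat \<Rightarrow> nat \<Rightarrow> nat set \<Rightarrow> (nat \<Rightarrow> nat) \<Rightarrow> (nat \<Rightarrow> nat) \<Rightarrow> 'a::field" where
  "char_proj q n T = coord_kernel q n (\<lambda>i. of_bool (i \<notin> T)) (\<lambda>i. of_bool (i \<in> T))"

text \<open>The vector \<open>l\<^sub>T\<close> of the overview, taken from the row of
  \<open>E\<^sub>T\<close> at \<open>u\<close>.\<close>

definition class_sums ::
  "nat \<Rightarrow> nat \<Rightarrow> nat \<Rightarrow> (nat \<Rightarrow> (nat \<Rightarrow> nat) set) \<Rightarrow> nat set \<Rightarrow> (nat \<Rightarrow> nat) \<Rightarrow> 'a::field vec" where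
  "class_sums q n r C T u = vec r (\<lambda>j. \<Sum>v\<in>C j. char_proj q n T u v)"

lemma finite_cube [simp]: "finite (cube q n)"
  by (simp add: cube_def finite_PiE)

text \<open>Averaging \<open>p\<close> and its complement \<open>1 - p\<close> are idempotents with
  product zero, so coefficients multiply separately.\<close>

lemma site_compose:
  assumes q: "of_nat q \<noteq> (0::'a::field)" and "a < q" "b < q"
  shows "(\<Sum>c<q. site q s t a c * site q s' t' c b) = (site q (s * s') (t * t') a b :: 'a)"
proof -
  \<comment> \<open>These are the off-diagonal values: each site is a constant plus a multiple of
    the Kronecker delta.\<close>
  define e e' where "e = (s - t) / of_nat q" and "e' = (s' - t') / of_nat q"
  have e: "site q s t a c = e + t * of_bool (a = c)" "site q s' t' c b = e' + t' * of_bool (c = b)" for c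
    by (simp_all add: site_def e_def e'_def diff_divide_distrib right_diff_distrib)
  have "(\<Sum>c<q. site q s t a c * site q s' t' c b) =
        (\<Sum>c<q. e * e' + (if c = a then t * e' else 0) + (if c = b then e * t' else 0)
          + (if c = a then t * t' * of_bool (a = b) else 0))"
    unfolding e by (intro sum.cong) (auto simp: algebra_simps)
  also have "\<dots> = of_nat q * e * e' + t * e' + e * t' + t * t' * of_bool (a = b)"
    using assms by (simp add: sum.distrib)
  also have "\<dots> = site q (s * s') (t * t') a b"
    using q by (simp add: e_def e'_def site_def field_simps)
  finally show ?thesis .
qed

text \<open>The sum over the cube of a product over coordinates factors, which leaves
  \<open>site_compose\<close> in each coordinate.\<close>

lemma coord_kernel_compose:
  assumes "of_nat q \<noteq> (0::'a::field)" "u \<in> cube q n" "v \<in> cube q n"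
  shows "(\<Sum>w\<in>cube q n. coord_kernel q n s t u w * coord_kernel q n s' t' w v) =
         (coord_kernel q n (\<lambda>i. s i * s' i) (\<lambda>i. t i * t' i) u v :: 'a)"
proof -
  have "(\<Sum>w\<in>cube q n. coord_kernel q n s t u w * coord_kernel q n s' t' w v) =
     (\<Sum>w\<in>{1..n} \<rightarrow>\<^sub>E {0..<q}. \<Prod>i=1..n. site q (s i) (t i) (u i) (w i) * site q (s' i) (t' i) (w i) (v i))"
    by (simp add: coord_kernel_def cube_def prod.distrib)
  also have "\<dots> = (\<Prod>i=1..n. \<Sum>c=0..<q. site q (s i) (t i) (u i) c * site q (s' i) (t' i) c (v i))"
    by (subst prod_sum_PiE) auto
  also have "\<dots> = coord_kernel q n (\<lambda>i. s i * s' i) (\<lambda>i. t i * t' i) u v"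
    unfolding coord_kernel_def
  proof (rule prod.cong)
    fix i assume "i \<in> {1..n}"
    then have "u i < q" "v i < q" using assms by (auto simp: cube_def PiE_iff)
    from site_compose[OF assms(1) this] 
    show "(\<Sum>c=0..<q. site q (s i) (t i) (u i) c * site q (s' i) (t' i) c (v i)) =
      site q (s i * s' i) (t i * t' i) (u i) (v i)" by (simp add: atLeast0LessThan)
  qed simp
  finally show ?thesis .
qed

lemma coord_kernel_one:
  assumes "u \<in> cube q n" "v \<in> cube q n"
  shows "coord_kernel q n (\<lambda>_. 1) (\<lambda>_. 1) u v = (of_bool (u = v) :: 'a::field)"
proof (cases "u = v")
  case False
  then obtain i where "i \<in> {1..n}" "u i \<noteq> v i"
    using assms PiE_ext unfolding cube_def by blast
  then show ?thesis using False
    by (auto simp: coord_kernel_def site_def intro!: prod_zero)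
qed (simp add: coord_kernel_def site_def)

text \<open>Multiply out the product of the \<open>s i * p\<^sub>i + t i * (1 - p\<^sub>i)\<close>;
  \<open>T\<close> records the coordinates where the summand with \<open>1 - p\<^sub>i\<close> is
  chosen.\<close>

lemma coord_kernel_expand:
  "coord_kernel q n s t u v =
     (\<Sum>T\<in>Pow {1..n}. (\<Prod>i\<in>T. t i) * (\<Prod>i\<in>{1..n} - T. s i) * char_proj q n T u v)"
proof -
  have "coord_kernel q n s t u v =
    (\<Prod>i=1..n. t i * site q 0 1 (u i) (v i) + s i * site q 1 0 (u i) (v i))"
    unfolding coord_kernel_def by (intro prod.cong) (auto simp: site_def)
  also have "\<dots> = (\<Sum>T\<in>Pow {1..n}. (\<Prod>i\<in>T. t i * site q 0 1 (u i) (v i)) *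
      (\<Prod>i\<in>{1..n} - T. s i * site q 1 0 (u i) (v i)))"
    by (rule prod_add) simp
  also have "\<dots> = (\<Sum>T\<in>Pow {1..n}. (\<Prod>i\<in>T. t i) * (\<Prod>i\<in>{1..n} - T. s i) * char_proj q n T u v)"
  proof (rule sum.cong)
    fix T assume T: "T \<in> Pow {1..n}"
    have "char_proj q n T u v =
      (\<Prod>i\<in>{1..n} - T. site q (of_bool (i \<notin> T)) (of_bool (i \<in> T)) (u i) (v i)) *
      (\<Prod>i\<in>T. site q (of_bool (i \<notin> T)) (of_bool (i \<in> T)) (u i) (v i))"
      unfolding char_proj_def coord_kernel_def by (rule prod.subset_diff) (use T in auto)
    also have "\<dots> = (\<Prod>i\<in>{1..n} - T. site q 1 0 (u i) (v i)) * (\<Prod>i\<in>T. site q 0 1 (u i) (v i))"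
      by (intro arg_cong2[of _ _ _ _ "(*)"] prod.cong) auto
    finally have split: "char_proj q n T u v = \<dots>" .
    show "(\<Prod>i\<in>T. t i * site q 0 1 (u i) (v i)) *
        (\<Prod>i\<in>{1..n} - T. s i * site q 1 0 (u i) (v i)) =
      (\<Prod>i\<in>T. t i) * (\<Prod>i\<in>{1..n} - T. s i) * char_proj q n T u v"
      unfolding split prod.distrib by (simp only: mult_ac)
  qed simp
  finally show ?thesis .
qed

lemma prod_of_bool:
  assumes "finite A"
  shows "(\<Prod>x\<in>A. of_bool (P x)) = (of_bool (\<forall>x\<in>A. P x) :: 'a::comm_semiring_1)"
  using assms by induction auto

section \<open>The adjacency operator and the color classes\<close>

text \<open>In a single coordinate, \<open>(q - 1) p - (1 - p)\<close> has entry 0 at equal and 1 at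
  different arguments, while \<open>s = t = 1\<close> gives the identity. The \<open>i\<close>-th
  summand is therefore the indicator of differing exactly in coordinate \<open>i\<close>.\<close>

lemma adjacency_coord_kernel:
  assumes "of_nat q \<noteq> (0::'a::field)"
  shows "(\<Sum>i=1..n. coord_kernel q n (\<lambda>j. if j = i then of_nat q - 1 else 1)
           (\<lambda>j. if j = i then -1 else 1) u v) = (of_bool (cube_adj n u v) :: 'a)"
proof -
  have ker: "coord_kernel q n (\<lambda>j. if j = i then of_nat q - 1 else 1) (\<lambda>j. if j = i then -1 else 1) u v
      = (of_bool (u i \<noteq> v i \<and> (\<forall>j\<in>{1..n}. j \<noteq> i \<longrightarrow> u j = v j)) :: 'a)" if "i \<in> {1..n}" for i
  proof -
    have "coord_kernel q n (\<lambda>j. if j = i then of_nat q - 1 else 1) (\<lambda>j. if j = i then -1 else 1) u v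
       = (\<Prod>j=1..n. (of_bool (if j = i then u j \<noteq> v j else u j = v j) :: 'a))"
      unfolding coord_kernel_def using assms
      by (intro prod.cong) (auto simp: site_def field_simps)
    also have "\<dots> = of_bool (\<forall>j\<in>{1..n}. if j = i then u j \<noteq> v j else u j = v j)"
      by (rule prod_of_bool) simp
    also have "(\<forall>j\<in>{1..n}. if j = i then u j \<noteq> v j else u j = v j) \<longleftrightarrow>
        u i \<noteq> v i \<and> (\<forall>j\<in>{1..n}. j \<noteq> i \<longrightarrow> u j = v j)"
      using that by auto
    finally show ?thesis .
  qed
  show ?thesis
  proof (cases "cube_adj n u v")
    case True
    then obtain k where k: "k \<in> {1..n}" "u k \<noteq> v k" "\<And>j. j \<in> {1..n} \<Longrightarrow> j \<noteq> k \<Longrightarrow> u j = v j"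
      unfolding cube_adj_def by metis
    have "(\<Sum>i=1..n. (of_bool (u i \<noteq> v i \<and> (\<forall>j\<in>{1..n}. j \<noteq> i \<longrightarrow> u j = v j)) :: 'a)) =
        (\<Sum>i=1..n. if i = k then 1 else 0)"
      using k by (intro sum.cong) auto
    then show ?thesis using True k by (simp add: ker)
  next
    case False
    have "\<not> (u i \<noteq> v i \<and> (\<forall>j\<in>{1..n}. j \<noteq> i \<longrightarrow> u j = v j))" if "i \<in> {1..n}" for i
      using False that unfolding cube_adj_def by metis
    then have "(\<Sum>i=1..n. (of_bool (u i \<noteq> v i \<and> (\<forall>j\<in>{1..n}. j \<noteq> i \<longrightarrow> u j = v j)) :: 'a)) = 0"
      by (intro sum.neutral) simp
    then show ?thesis using False by (simp add: ker)
  qed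
qed

text \<open>The \<open>i\<close>-th summand of the adjacency operator acts on the range of
  \<open>E\<^sub>T\<close> as \<open>-1\<close> if \<open>i \<in> T\<close> and as
  \<open>q - 1\<close> otherwise; the eigenvalue is the sum of these scalars.\<close>

lemma char_proj_adjacency:
  assumes q: "of_nat q \<noteq> (0::'a::field)" and T: "T \<subseteq> {1..n}"
    and u: "u \<in> cube q n" and v: "v \<in> cube q n"
  shows "(\<Sum>w\<in>cube q n. char_proj q n T u w * of_bool (cube_adj n w v)) =
         ((of_nat q - 1) * of_nat n - of_nat q * of_nat (card T)) * (char_proj q n T u v :: 'a)"
proof -
  let ?A = "\<lambda>i. coord_kernel q n (\<lambda>j. if j = i then of_nat q - 1 else 1) (\<lambda>j. if j = i then -1 else (1::'a))"
  have one: "(\<Sum>w\<in>cube q n. char_proj q n T u w * ?A i w v) =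
    (of_nat q - 1 - of_nat q * of_bool (i \<in> T)) * char_proj q n T u v" if i: "i \<in> {1..n}" for i
  proof -
    have "(\<Sum>w\<in>cube q n. char_proj q n T u w * ?A i w v) =
      coord_kernel q n (\<lambda>j. of_bool (j \<notin> T) * (if j = i then of_nat q - 1 else 1))
        (\<lambda>j. of_bool (j \<in> T) * (if j = i then -1 else 1)) u v"
      unfolding char_proj_def by (rule coord_kernel_compose[OF q u v])
    \<comment> \<open>Exactly one of the two coefficients at \<open>i\<close> is nonzero, so the
      adjacency coefficient leaves the site as a scalar.\<close>
    also have "\<dots> = (\<Prod>j=1..n. (if j = i then of_nat q - 1 - of_nat q * of_bool (i \<in> T) else 1) *
        site q (of_bool (j \<notin> T)) (of_bool (j \<in> T)) (u j) (v j))"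
      unfolding coord_kernel_def by (intro prod.cong) (auto simp: site_def)
    also have "\<dots> = (of_nat q - 1 - of_nat q * of_bool (i \<in> T)) * char_proj q n T u v"
      using i by (simp add: prod.distrib char_proj_def coord_kernel_def)
    finally show ?thesis .
  qed
  have "(\<Sum>w\<in>cube q n. char_proj q n T u w * of_bool (cube_adj n w v)) =
      (\<Sum>i=1..n. \<Sum>w\<in>cube q n. char_proj q n T u w * ?A i w v)"
    unfolding adjacency_coord_kernel[OF q, symmetric] sum_distrib_left by (rule sum.swap)
  also have "\<dots> = (\<Sum>i=1..n. of_nat q - 1 - of_nat q * of_bool (i \<in> T)) * char_proj q n T u v"
    unfolding sum_distrib_right by (intro sum.cong refl one)
  also have "(\<Sum>i=1..n. of_nat q - 1 - of_nat q * of_bool (i \<in> T)) =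
      (of_nat q - 1) * of_nat n - of_nat q * (of_nat (card T) :: 'a)"
    using T by (simp add: sum_subtractf sum_distrib_left[symmetric] Int_absorb1 mult.commute of_bool_def
        sum.If_cases Collect_mem_eq)
  finally show ?thesis .
qed

text \<open>The adjacency operator sends the indicator of \<open>C j\<close> to the function with
  value \<open>S $$ (i, j)\<close> on \<open>C i\<close>. Applying a row of \<open>E\<^sub>T\<close>
  to this function and evaluating the double sum in the other order gives the eigenvalue.\<close>

lemma class_sums_coloring:
  assumes q: "of_nat q \<noteq> (0::'a::field)" and pc: "perfect_coloring q n r C S"
    and T: "T \<subseteq> {1..n}" and u: "u \<in> cube q n" and j: "j < r"
  shows "(\<Sum>i<r. class_sums q n r C T u $ i * of_nat (S $$ (i, j))) =
    ((of_nat q - 1) * of_nat n - of_nat q * of_nat (card T)) * (class_sums q n r C T u $ j :: 'a)"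
proof -
  have disj: "disjoint_family_on C {..<r}" and cov: "(\<Union>i<r. C i) = cube q n"
    and adj: "\<And>i w. i < r \<Longrightarrow> w \<in> C i \<Longrightarrow> card {v \<in> C j. cube_adj n w v} = S $$ (i, j)"
    using pc j by (auto simp: perfect_coloring_def)
  have sub: "C i \<subseteq> cube q n" if "i < r" for i using cov that by auto
  have fin: "finite (C i)" if "i < r" for i using finite_subset[OF sub[OF that]] by simp
  let ?P = "\<lambda>w. char_proj q n T u w :: 'a"
  have "(\<Sum>i<r. class_sums q n r C T u $ i * of_nat (S $$ (i, j))) =
      (\<Sum>i<r. \<Sum>w\<in>C i. ?P w * (\<Sum>v\<in>C j. of_bool (cube_adj n w v)))"
  proof (rule sum.cong)
    fix i assume i: "i \<in> {..<r}"
    have "(\<Sum>v\<in>C j. of_bool (cube_adj n w v)) = (of_nat (S $$ (i, j)) :: 'a)" if "w \<in> C i" for w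
    proof -
      have "(\<Sum>v\<in>C j. of_bool (cube_adj n w v)) = (of_nat (card {v \<in> C j. cube_adj n w v}) :: 'a)"
        using fin[OF j] by (simp add: of_bool_def sum.If_cases Int_def)
      then show ?thesis using adj i that by simp
    qed
    then show "class_sums q n r C T u $ i * of_nat (S $$ (i, j)) =
        (\<Sum>w\<in>C i. ?P w * (\<Sum>v\<in>C j. of_bool (cube_adj n w v)))"
      using i by (simp add: class_sums_def sum_distrib_right)
  qed simp
  also have "\<dots> = (\<Sum>w\<in>cube q n. ?P w * (\<Sum>v\<in>C j. of_bool (cube_adj n w v)))"
    unfolding cov[symmetric] using disj fin
    by (subst sum.UNION_disjoint) (auto simp: disjoint_family_on_def)
  also have "\<dots> = (\<Sum>v\<in>C j. \<Sum>w\<in>cube q n. ?P w * of_bool (cube_adj n w v))"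
    unfolding sum_distrib_left by (rule sum.swap)
  also have "\<dots> = (\<Sum>v\<in>C j. ((of_nat q - 1) * of_nat n - of_nat q * of_nat (card T)) * ?P v)"
    using sub[OF j] by (intro sum.cong refl char_proj_adjacency q T u) auto
  also have "\<dots> = ((of_nat q - 1) * of_nat n - of_nat q * of_nat (card T)) * (class_sums q n r C T u $ j)"
    using j by (simp add: class_sums_def sum_distrib_left)
  finally show ?thesis .
qed

text \<open>Since the \<open>E\<^sub>T\<close> sum to the identity, the vectors
  \<open>class_sums q n r C T u\<close> with \<open>u \<in> C j\<close> sum over \<open>T\<close> to
  the \<open>j\<close>-th unit vector. Such a \<open>u\<close> exists because color classes are
  nonempty.\<close>

lemma class_sums_separate:
  fixes x :: "'a::field vec"
  assumes pc: "perfect_coloring q n r C S" and x: "x \<in> carrier_vec r"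
    and orth: "\<And>T u. T \<subseteq> {1..n} \<Longrightarrow> u \<in> cube q n \<Longrightarrow> class_sums q n r C T u \<bullet> x = 0"
  shows "x = 0\<^sub>v r"
proof (rule eq_vecI)
  fix j assume "j < dim_vec (0\<^sub>v r :: 'a vec)"
  then have j: "j < r" by simp
  have disj: "disjoint_family_on C {..<r}" and cov: "(\<Union>i<r. C i) = cube q n" and "C j \<noteq> {}"
    using pc j by (auto simp: perfect_coloring_def)
  then obtain u where u: "u \<in> C j" by auto
  have sub: "C i \<subseteq> cube q n" if "i < r" for i using cov that by auto
  have fin: "finite (C i)" if "i < r" for i using finite_subset[OF sub[OF that]] by simp
  have ucube: "u \<in> cube q n" using u sub j by auto
  have "0 = (\<Sum>T\<in>Pow {1..n}. class_sums q n r C T u \<bullet> x)"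
    using orth ucube by simp
  also have "\<dots> = (\<Sum>T\<in>Pow {1..n}. \<Sum>i<r. \<Sum>v\<in>C i. char_proj q n T u v * x $ i)"
    using x by (simp add: scalar_prod_def class_sums_def atLeast0LessThan sum_distrib_right)
  also have "\<dots> = (\<Sum>i<r. \<Sum>T\<in>Pow {1..n}. \<Sum>v\<in>C i. char_proj q n T u v * x $ i)"
    by (rule sum.swap)
  also have "\<dots> = (\<Sum>i<r. \<Sum>v\<in>C i. \<Sum>T\<in>Pow {1..n}. char_proj q n T u v * x $ i)"
    by (intro sum.cong refl sum.swap)
  also have "\<dots> = (\<Sum>i<r. \<Sum>v\<in>C i. of_bool (u = v) * x $ i)"
  proof (intro sum.cong refl)
    fix i v assume "i \<in> {..<r}" "v \<in> C i"
    then have "v \<in> cube q n" using sub by auto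
    then show "(\<Sum>T\<in>Pow {1..n}. char_proj q n T u v * x $ i) = of_bool (u = v) * x $ i"
      using coord_kernel_expand[of q n "\<lambda>_. 1" "\<lambda>_. 1::'a" u v] coord_kernel_one[OF ucube, of v, where 'a='a]
      by (simp add: sum_distrib_right)
  qed
  also have "\<dots> = (\<Sum>i<r. if i = j then x $ j else 0)"
  proof (rule sum.cong)
    fix i assume i: "i \<in> {..<r}"
    have "u \<in> C i \<longleftrightarrow> i = j" using u disj i j by (auto simp: disjoint_family_on_def)
    then show "(\<Sum>v\<in>C i. of_bool (u = v) * x $ i) = (if i = j then x $ j else 0)"
      using fin[of i] i by (simp add: sum_distrib_right[symmetric] of_bool_def)
  qed simp
  also have "\<dots> = x $ j" using j by simp
  finally show "x $ j = 0\<^sub>v r $ j" using j by simp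
qed (use x in auto)

section \<open>Local weight enumerators in terms of class sums\<close>

text \<open>Inside \<open>J\<close> the site has value \<open>x\<close> at equal and
  \<open>y\<close> at different arguments. Outside \<open>J\<close> it is the Kronecker delta, which
  restricts the sum to the face.\<close>

lemma local_weight_enum_eq_sum:
  fixes x y :: "'a::field"
  assumes q: "of_nat q \<noteq> (0::'a)" and B: "B \<subseteq> cube q n" and J: "J \<subseteq> {1..n}"
  shows "local_weight_enum q n B J \<alpha> x y =
    (\<Sum>v\<in>B. coord_kernel q n (\<lambda>i. if i \<in> J then x + (of_nat q - 1) * y else 1)
              (\<lambda>i. if i \<in> J then x - y else 1) \<alpha> v)"
proof -
  have finJ: "finite J" using J finite_subset by blast
  have finB: "finite B" using B finite_subset finite_cube by blast
  let ?B = "B \<inter> face q n J \<alpha>"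
  let ?d = "hamming_dist n \<alpha>"
  have dist: "?d v = card {i \<in> J. \<alpha> i \<noteq> v i}" if "v \<in> face q n J \<alpha>" for v
  proof -
    have "i \<in> J" if "i \<in> {1..n}" "\<alpha> i \<noteq> v i" for i
    proof (rule ccontr)
      assume "i \<notin> J"
      then have "v i = \<alpha> i" using \<open>v \<in> face q n J \<alpha>\<close> that by (simp add: face_def)
      then show False using that by simp
    qed
    then have "{i \<in> {1..n}. \<alpha> i \<noteq> v i} = {i \<in> J. \<alpha> i \<noteq> v i}" using J by blast
    then show ?thesis by (simp add: hamming_dist_def)
  qed
  have ker: "coord_kernel q n (\<lambda>i. if i \<in> J then x + (of_nat q - 1) * y else 1)
              (\<lambda>i. if i \<in> J then x - y else 1) \<alpha> v =
    (if v \<in> face q n J \<alpha> then y ^ ?d v * x ^ (card J - ?d v) else 0)" if "v \<in> B" for v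
  proof -
    have "coord_kernel q n (\<lambda>i. if i \<in> J then x + (of_nat q - 1) * y else 1)
              (\<lambda>i. if i \<in> J then x - y else 1) \<alpha> v =
      (\<Prod>i=1..n. if i \<in> J then if \<alpha> i = v i then x else y else of_bool (\<alpha> i = v i))"
      unfolding coord_kernel_def using q by (intro prod.cong) (auto simp: site_def field_simps)
    also have "\<dots> = (if v \<in> face q n J \<alpha> then y ^ ?d v * x ^ (card J - ?d v) else 0)"
    proof (cases "v \<in> face q n J \<alpha>")
      case True
      then have "(\<Prod>i=1..n. if i \<in> J then if \<alpha> i = v i then x else y else of_bool (\<alpha> i = v i)) =
        (\<Prod>i\<in>J. if \<alpha> i = v i then x else y)"
        using J by (intro prod.mono_neutral_cong_right) (auto simp: face_def)
      also have "\<dots> = x ^ card (J \<inter> {i. \<alpha> i = v i}) * y ^ card (J \<inter> - {i. \<alpha> i = v i})"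
        using finJ by (simp add: prod.If_cases)
      also have "J \<inter> - {i. \<alpha> i = v i} = {i \<in> J. \<alpha> i \<noteq> v i}" by auto
      also have "J \<inter> {i. \<alpha> i = v i} = J - {i \<in> J. \<alpha> i \<noteq> v i}" by auto
      also have "card (J - {i \<in> J. \<alpha> i \<noteq> v i}) = card J - ?d v"
        using dist[OF True] finJ by (simp add: card_Diff_subset)
      finally show ?thesis using True dist[OF True] by (simp add: mult.commute)
    next
      case False
      then obtain i where "i \<in> {1..n} - J" "v i \<noteq> \<alpha> i"
        using subsetD[OF B] \<open>v \<in> B\<close> by (auto simp: face_def)
      then show ?thesis using False by (auto intro!: prod_zero bexI[of _ i])
    qed
    finally show ?thesis .
  qed
  have le: "?d v \<le> card J" if "v \<in> ?B" for v
    using that dist[of v] finJ by (auto intro!: card_mono)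
  have "(\<Sum>v\<in>B. coord_kernel q n (\<lambda>i. if i \<in> J then x + (of_nat q - 1) * y else 1)
              (\<lambda>i. if i \<in> J then x - y else 1) \<alpha> v) =
        (\<Sum>v\<in>?B. y ^ ?d v * x ^ (card J - ?d v))"
    using finB by (simp add: ker sum.inter_restrict)
  also have "\<dots> = (\<Sum>j\<in>{0..card J}. \<Sum>v\<in>{v \<in> ?B. ?d v = j}. y ^ ?d v * x ^ (card J - ?d v))"
    using le finB by (intro sum.group[symmetric]) auto
  also have "\<dots> = local_weight_enum q n B J \<alpha> x y"
    unfolding local_weight_enum_def
  proof (rule sum.cong)
    fix j assume "j \<in> {0..card J}"
    have "{v \<in> ?B. ?d v = j} = B \<inter> sphere_at q n j \<alpha> \<inter> face q n J \<alpha>"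
      using B by (auto simp: sphere_at_def)
    moreover have "(\<Sum>v\<in>{v \<in> ?B. ?d v = j}. y ^ ?d v * x ^ (card J - ?d v)) =
       (\<Sum>v\<in>{v \<in> ?B. ?d v = j}. y ^ j * x ^ (card J - j))"
      by (rule sum.cong) auto
    ultimately show "(\<Sum>v\<in>{v \<in> ?B. ?d v = j}. y ^ ?d v * x ^ (card J - ?d v)) =
       of_nat (card (B \<inter> sphere_at q n j \<alpha> \<inter> face q n J \<alpha>)) * y ^ j * x ^ (card J - j)"
      by (simp add: mult.assoc)
  qed simp
  finally show ?thesis by simp
qed

text \<open>Coordinates outside \<open>J\<close> have both coefficients 1, so in the expansion only
  \<open>T \<inter> J\<close> and \<open>J - T\<close> contribute powers.\<close>

lemma local_weight_enum_eq_class_sums: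
  fixes x y :: "'a::field"
  assumes q: "of_nat q \<noteq> (0::'a)" and pc: "perfect_coloring q n r C S"
    and J: "J \<subseteq> {1..n}" and j: "j < r"
  shows "local_weight_enum q n (C j) J \<alpha> x y =
    (\<Sum>T\<in>Pow {1..n}. (x - y) ^ card (T \<inter> J) * (x + (of_nat q - 1) * y) ^ card (J - T) *
       class_sums q n r C T \<alpha> $ j)"
proof -
  have "C j \<subseteq> cube q n" using pc j by (auto simp: perfect_coloring_def)
  then have "local_weight_enum q n (C j) J \<alpha> x y =
    (\<Sum>v\<in>C j. coord_kernel q n (\<lambda>i. if i \<in> J then x + (of_nat q - 1) * y else 1)
              (\<lambda>i. if i \<in> J then x - y else 1) \<alpha> v)"
    by (rule local_weight_enum_eq_sum[OF q _ J])
  also have "\<dots> = (\<Sum>v\<in>C j. \<Sum>T\<in>Pow {1..n}. (x - y) ^ card (T \<inter> J) *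
      (x + (of_nat q - 1) * y) ^ card (J - T) * char_proj q n T \<alpha> v)"
  proof (intro sum.cong refl)
    fix v
    have *: "(\<Prod>i\<in>T. if i \<in> J then x - y else 1) = (x - y) ^ card (T \<inter> J)"
      "(\<Prod>i\<in>{1..n} - T. if i \<in> J then x + (of_nat q - 1) * y else 1) =
        (x + (of_nat q - 1) * y) ^ card (J - T)" if "T \<in> Pow {1..n}" for T
    proof -
      have "finite T" using that finite_subset by auto
      moreover have "({1..n} - T) \<inter> J = J - T" using J by auto
      ultimately show "(\<Prod>i\<in>T. if i \<in> J then x - y else 1) = (x - y) ^ card (T \<inter> J)"
        "(\<Prod>i\<in>{1..n} - T. if i \<in> J then x + (of_nat q - 1) * y else 1) =
          (x + (of_nat q - 1) * y) ^ card (J - T)"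
        by (simp_all add: prod.If_cases)
    qed
    show "coord_kernel q n (\<lambda>i. if i \<in> J then x + (of_nat q - 1) * y else 1)
              (\<lambda>i. if i \<in> J then x - y else 1) \<alpha> v = (\<Sum>T\<in>Pow {1..n}. (x - y) ^ card (T \<inter> J) *
      (x + (of_nat q - 1) * y) ^ card (J - T) * char_proj q n T \<alpha> v)"
      unfolding coord_kernel_expand[of _ _ _ _ \<alpha> v] by (intro sum.cong refl) (simp only: *)
  qed
  also have "\<dots> = (\<Sum>T\<in>Pow {1..n}. \<Sum>v\<in>C j. (x - y) ^ card (T \<inter> J) *
      (x + (of_nat q - 1) * y) ^ card (J - T) * char_proj q n T \<alpha> v)"
    by (rule sum.swap)
  finally show ?thesis using j by (simp add: class_sums_def sum_distrib_left)
qed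

section \<open>Diagonalization by left eigenvectors, and matrix powers\<close>

text \<open>The rows of the identity matrix are replaced one by one. The next row may be any \<open>l \<in> L\<close> that does
  not vanish on the corresponding column of the inverse of the current matrix.\<close>

lemma exists_nonsingular_rows:
  fixes L :: "'a::field vec set"
  assumes L: "L \<subseteq> carrier_vec r"
    and sep: "\<And>x. x \<in> carrier_vec r \<Longrightarrow> (\<forall>l\<in>L. l \<bullet> x = 0) \<Longrightarrow> x = 0\<^sub>v r"
    and k: "k \<le> r"
  shows "\<exists>M\<in>carrier_mat r r. det M \<noteq> 0 \<and> (\<forall>i<k. row M i \<in> L)"
  using k
proof (induction k)
  case 0
  show ?case by (intro bexI[of _ "1\<^sub>m r"]) auto
next
  case (Suc k)
  then obtain M where M: "M \<in> carrier_mat r r" and dM: "det M \<noteq> 0" and rows: "\<And>i. i < k \<Longrightarrow> row M i \<in> L"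
    by auto
  have k: "k < r" using Suc.prems by simp
  obtain N where N: "N \<in> carrier_mat r r" "M * N = 1\<^sub>m r" "N * M = 1\<^sub>m r"
    using det_non_zero_imp_unit[OF M dM, of "()"] by (auto simp: Units_def ring_mat_def)
  define v where "v = N *\<^sub>v unit_vec r k"
  have v: "v \<in> carrier_vec r" using N by (simp add: v_def)
  have Mv: "M *\<^sub>v v = unit_vec r k"
    using N M by (simp add: v_def flip: assoc_mult_mat_vec[of _ r r _ r])
  have "v \<noteq> 0\<^sub>v r"
  proof
    assume "v = 0\<^sub>v r"
    moreover have "M *\<^sub>v 0\<^sub>v r = 0\<^sub>v r" using M by (intro eq_vecI) auto
    ultimately have "unit_vec r k = (0\<^sub>v r :: 'a vec)" using Mv by simp
    then have "unit_vec r k $ k = (0\<^sub>v r :: 'a vec) $ k" by simp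
    then show False using k by simp
  qed
  then obtain l where l: "l \<in> L" "l \<bullet> v \<noteq> 0" using sep[OF v] by auto
  have lr: "l \<in> carrier_vec r" using l L by auto
  define M' where "M' = mat r r (\<lambda>(i, j). if i = k then l $ j else M $$ (i, j))"
  have M': "M' \<in> carrier_mat r r" by (simp add: M'_def)
  have row': "row M' i = (if i = k then l else row M i)" if "i < r" for i
    using that lr M by (auto simp: M'_def)
  have "det M' \<noteq> 0"
  proof
    assume "det M' = 0"
    then obtain x where x: "x \<in> carrier_vec r" "x \<noteq> 0\<^sub>v r" "M' *\<^sub>v x = 0\<^sub>v r"
      using det_0_iff_vec_prod_zero[OF M'] by auto
    have row0: "(if i = k then l else row M i) \<bullet> x = 0" if "i < r" for i
      using arg_cong[OF x(3), of "\<lambda>y. y $ i"] that M' row'[OF that] by simp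
    have lx: "l \<bullet> x = 0" using row0[OF k] by simp
    have other: "row M i \<bullet> x = 0" if "i < r" "i \<noteq> k" for i using row0[OF that(1)] that by simp
    \<comment> \<open>All rows but the \<open>k\<close>-th annihilate \<open>x\<close>, so
      \<open>x\<close> is a multiple of \<open>v\<close>. As \<open>l\<close> annihilates
      \<open>x\<close> but not \<open>v\<close>, that multiple is zero.\<close>
    have "M *\<^sub>v x = (row M k \<bullet> x) \<cdot>\<^sub>v unit_vec r k"
      using M other k by (intro eq_vecI) auto
    then have "N *\<^sub>v (M *\<^sub>v x) = (row M k \<bullet> x) \<cdot>\<^sub>v v"
      using N by (simp add: v_def mult_mat_vec[of _ r r])
    moreover have "N *\<^sub>v (M *\<^sub>v x) = x"
      using N M x by (simp flip: assoc_mult_mat_vec[of _ r r _ r])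
    ultimately have xv: "x = (row M k \<bullet> x) \<cdot>\<^sub>v v" by simp
    then have "l \<bullet> x = (row M k \<bullet> x) * (l \<bullet> v)"
      using lr v by (metis scalar_prod_smult_distrib)
    then have "row M k \<bullet> x = 0" using lx l by simp
    then have "x = 0 \<cdot>\<^sub>v v" using xv by simp
    then have "x = 0\<^sub>v r" using v by auto
    then show False using x by simp
  qed
  then show ?case using M' row' rows l k by (intro bexI[of _ M']) (auto simp: less_Suc_eq)
qed

text \<open>Some \<open>r\<close> vectors of \<open>L\<close> form the rows of an invertible
  \<open>Q\<close>. Being left eigenvectors, they give \<open>Q * A = D * Q\<close>, so
  \<open>Q\<close> and its inverse diagonalize \<open>A\<close>. With \<open>f = of_int\<close> the
  diagonal is integral, as \<open>is_mat_powi\<close> requires.\<close>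

lemma diagonalizable_of_separating_left_eigenvectors:
  fixes A :: "'a::field mat"
  assumes A: "A \<in> carrier_mat r r" and L: "L \<subseteq> carrier_vec r"
    and eig: "\<And>l. l \<in> L \<Longrightarrow> \<exists>k. A\<^sup>T *\<^sub>v l = f k \<cdot>\<^sub>v l"
    and sep: "\<And>x. x \<in> carrier_vec r \<Longrightarrow> (\<forall>l\<in>L. l \<bullet> x = 0) \<Longrightarrow> x = 0\<^sub>v r"
  shows "\<exists>P Q a. similar_mat_wit A (mat_diag r (\<lambda>i. f (a i))) P Q"
proof -
  obtain Q where Q: "Q \<in> carrier_mat r r" "det Q \<noteq> 0" and rows: "\<And>i. i < r \<Longrightarrow> row Q i \<in> L"
    using exists_nonsingular_rows[OF L sep order_refl] by auto
  obtain P where P: "P \<in> carrier_mat r r" "P * Q = 1\<^sub>m r" "Q * P = 1\<^sub>m r"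
    using det_non_zero_imp_unit[OF Q, of "()"] by (auto simp: Units_def ring_mat_def)
  have "\<forall>i\<in>{..<r}. \<exists>k. A\<^sup>T *\<^sub>v row Q i = f k \<cdot>\<^sub>v row Q i"
    using eig rows by auto
  from bchoice[OF this] obtain a where
    a: "\<And>i. i < r \<Longrightarrow> A\<^sup>T *\<^sub>v row Q i = f (a i) \<cdot>\<^sub>v row Q i"
    by auto
  define D where "D = mat_diag r (\<lambda>i. f (a i))"
  have D: "D \<in> carrier_mat r r" by (simp add: D_def mat_diag_def)
  have "Q * A = D * Q"
  proof (rule eq_matI)
    fix i j assume "i < dim_row (D * Q)" "j < dim_col (D * Q)"
    then have ij: "i < r" "j < r" using D Q by auto
    have "(Q * A) $$ (i, j) = (A\<^sup>T *\<^sub>v row Q i) $ j"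
      using ij Q A by (simp add: comm_scalar_prod[of _ r])
    also have "\<dots> = (D * Q) $$ (i, j)"
      unfolding D_def using ij Q a by (simp add: mat_diag_mult_left[OF Q(1)])
    finally show "(Q * A) $$ (i, j) = (D * Q) $$ (i, j)" .
  qed (use Q A D in auto)
  then have "P * D * Q = P * (Q * A)"
    using P Q D by (simp add: assoc_mult_mat[of _ r r _ r _ r])
  also have "\<dots> = A"
    using P Q A by (simp flip: assoc_mult_mat[of _ r r _ r _ r])
  finally have "similar_mat_wit A D P Q"
    using P Q A D by (intro similar_mat_witI) auto
  then show ?thesis unfolding D_def by blast
qed

text \<open>Write \<open>l\<close> as a combination of the rows of \<open>Q\<close>, with
  coefficient vector \<open>m\<close>. The eigenvector equation confines \<open>m\<close> to the
  indices with \<open>a i = k\<close>, and there the diagonal of the power is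
  \<open>z powi k\<close>.\<close>

lemma is_mat_powi_left_eigenvector:
  assumes M: "is_mat_powi z A M" and A: "A \<in> carrier_mat r r" and l: "l \<in> carrier_vec r"
    and eig: "(map_mat rf_const A)\<^sup>T *\<^sub>v l = of_int k \<cdot>\<^sub>v l"
  shows "M\<^sup>T *\<^sub>v l = (z powi k) \<cdot>\<^sub>v l"
proof -
  have r: "dim_row A = r" using A by auto
  obtain P Q a where wit: "similar_mat_wit A (mat_diag r (\<lambda>i. of_int (a i))) P Q"
    and M_eq: "M = map_mat rf_const P * mat_diag r (\<lambda>i. z powi a i) * map_mat rf_const Q"
    using M unfolding is_mat_powi_def r by blast
  note PQ = similar_mat_witD[OF r[symmetric] wit]
  let ?e = "map_mat rf_const"
  define D where "D = (mat_diag r (\<lambda>i. of_int (a i)) :: ratfun2 mat)"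
  define Z where "Z = mat_diag r (\<lambda>i. z powi a i)"
  have car: "?e P \<in> carrier_mat r r" "?e Q \<in> carrier_mat r r" "D \<in> carrier_mat r r" "Z \<in> carrier_mat r r"
    using PQ by (auto simp: D_def Z_def mat_diag_def)
  have hm: "?e (X * Y) = ?e X * ?e Y" if "X \<in> carrier_mat r r" "Y \<in> carrier_mat r r" for X Y
    using rf_const_hom.mat_hom_mult[OF that] .
  have "?e (mat_diag r (\<lambda>i. of_int (a i))) = D"
    by (rule eq_matI) (auto simp: D_def mat_diag_def rf_const_hom.hom_of_int)
  then have eA: "?e A = ?e P * D * ?e Q"
    unfolding PQ(3) using PQ(5-7) by (simp add: hm)
  have "?e P * ?e Q = 1\<^sub>m r"
    using hm[OF PQ(6,7)] PQ(1) rf_const_hom.mat_hom_one by simp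
  then have inv: "(?e Q)\<^sup>T * (?e P)\<^sup>T = 1\<^sub>m r"
    using car by (metis transpose_mult transpose_one)
  have "?e Q * ?e P = 1\<^sub>m r"
    using hm[OF PQ(7,6)] PQ(2) rf_const_hom.mat_hom_one by simp
  then have inv': "(?e P)\<^sup>T * (?e Q)\<^sup>T = 1\<^sub>m r"
    using car by (metis transpose_mult transpose_one)
  define m where "m = (?e P)\<^sup>T *\<^sub>v l"
  have m: "m \<in> carrier_vec r" unfolding m_def using car l by (intro mult_mat_vec_carrier) auto
  have lm: "l = (?e Q)\<^sup>T *\<^sub>v m"
    unfolding m_def using inv car l by (simp flip: assoc_mult_mat_vec[of _ r r _ r])
  have diagT: "D\<^sup>T = D" "Z\<^sup>T = Z"
    by (auto simp: D_def Z_def mat_diag_def intro!: eq_matI)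
  have "D *\<^sub>v m = of_int k \<cdot>\<^sub>v m"
  proof -
    have "(?e A)\<^sup>T = (?e Q)\<^sup>T * (D * (?e P)\<^sup>T)"
      unfolding eA using car diagT
      by (simp add: transpose_mult[of _ r r _ r])
    then have "(?e P)\<^sup>T *\<^sub>v ((?e A)\<^sup>T *\<^sub>v l) = (?e P)\<^sup>T *\<^sub>v ((?e Q)\<^sup>T *\<^sub>v (D *\<^sub>v m))"
      using car l by (simp add: m_def assoc_mult_mat_vec[of _ r r _ r])
    also have "\<dots> = D *\<^sub>v m"
      using inv' car mult_mat_vec_carrier[OF car(3) m]
      by (subst assoc_mult_mat_vec[symmetric, of _ r r _ r]) auto
    finally have "D *\<^sub>v m = (?e P)\<^sup>T *\<^sub>v (of_int k \<cdot>\<^sub>v l)" unfolding eig by simp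
    also have "\<dots> = of_int k \<cdot>\<^sub>v m"
      unfolding m_def using car by (intro mult_mat_vec[OF _ l]) auto
    finally show ?thesis .
  qed
  have comp: "m $ i = 0 \<or> a i = k" if i: "i < r" for i
  proof -
    have "(D *\<^sub>v m) $ i = of_int (a i) * m $ i"
      using i m by (simp add: D_def mat_diag_def scalar_prod_def if_distrib if_distribR cong: if_cong)
    then have "(of_int (a i) :: ratfun2) * m $ i = of_int k * m $ i"
      using \<open>D *\<^sub>v m = _\<close> i m by auto
    \<comment> \<open>Distinct integers stay distinct in \<open>ratfun2\<close> because they do so
      in \<open>complex\<close> and \<open>rf_const\<close> is injective.\<close>
    moreover have "of_int (a i) = (of_int k :: ratfun2) \<longleftrightarrow> a i = k"
      by (metis of_int_eq_iff rf_const_hom.hom_of_int rf_const_hom.eq_iff)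
    ultimately show ?thesis by auto
  qed
  have "Z *\<^sub>v m = (z powi k) \<cdot>\<^sub>v m"
  proof (rule eq_vecI)
    fix i assume "i < dim_vec ((z powi k) \<cdot>\<^sub>v m)"
    then have i: "i < r" using m by simp
    have "(Z *\<^sub>v m) $ i = z powi a i * m $ i"
      using i m by (simp add: Z_def mat_diag_def scalar_prod_def if_distrib if_distribR cong: if_cong)
    then show "(Z *\<^sub>v m) $ i = ((z powi k) \<cdot>\<^sub>v m) $ i"
      using comp[OF i] i m by auto
  qed (use car m in auto)
  moreover have "M\<^sup>T *\<^sub>v l = (?e Q)\<^sup>T *\<^sub>v (Z *\<^sub>v m)"
  proof -
    have "M\<^sup>T = (?e Q)\<^sup>T * (Z * (?e P)\<^sup>T)"
      unfolding M_eq Z_def[symmetric] using car diagT by (simp add: transpose_mult[of _ r r _ r])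
    then show ?thesis using car l by (simp add: m_def assoc_mult_mat_vec[of _ r r _ r])
  qed
  ultimately show ?thesis
    using lm car m by (simp add: mult_mat_vec[of _ r r])
qed

section \<open>Class sums under powers of \<open>h(S)\<close>\<close>

text \<open>The hypothesis \<open>ent\<close> is \<open>A = h(S) - m E\<close> with the denominator
  \<open>q\<close> cleared. In this form it covers both the complex matrix and its image over
  \<open>ratfun2\<close>.\<close>

lemma class_sums_left_eigenvector:
  fixes A :: "'a::field mat"
  assumes q: "of_nat q \<noteq> (0::'a)" and pc: "perfect_coloring q n r C S"
    and A: "A \<in> carrier_mat r r"
    and ent: "\<And>i j. i < r \<Longrightarrow> j < r \<Longrightarrow> of_nat q * A $$ (i, j) =
      of_bool (i = j) * ((of_nat q - 1) * of_nat n - of_nat q * of_nat m) - of_nat (S $$ (i, j))"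
    and T: "T \<subseteq> {1..n}" and u: "u \<in> cube q n"
  shows "A\<^sup>T *\<^sub>v class_sums q n r C T u = of_int (int (card T) - int m) \<cdot>\<^sub>v class_sums q n r C T u"
proof (rule eq_vecI)
  let ?l = "class_sums q n r C T u :: 'a vec"
  have dim: "dim_vec ?l = r" by (simp add: class_sums_def)
  fix j assume "j < dim_vec (of_int (int (card T) - int m) \<cdot>\<^sub>v ?l)"
  then have j: "j < r" using dim by simp
  let ?c = "(of_nat q - 1) * of_nat n - of_nat q * of_nat m :: 'a"
  have "(A\<^sup>T *\<^sub>v ?l) $ j = (\<Sum>i<r. A $$ (i, j) * ?l $ i)"
    using A j dim by (simp add: scalar_prod_def atLeast0LessThan)
  then have "of_nat q * (A\<^sup>T *\<^sub>v ?l) $ j = (\<Sum>i<r. (of_nat q * A $$ (i, j)) * ?l $ i)"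
    by (simp add: sum_distrib_left mult.assoc)
  also have "\<dots> = (\<Sum>i<r. (if i = j then ?c * ?l $ j else 0) - ?l $ i * of_nat (S $$ (i, j)))"
    using j by (intro sum.cong) (auto simp: ent algebra_simps)
  also have "\<dots> = ?c * ?l $ j - (\<Sum>i<r. ?l $ i * of_nat (S $$ (i, j)))"
    using j by (simp add: sum_subtractf)
  also have "\<dots> = of_nat q * (of_int (int (card T) - int m) * ?l $ j)"
    unfolding class_sums_coloring[OF q pc T u j] by (simp add: algebra_simps)
  finally show "(A\<^sup>T *\<^sub>v ?l) $ j = (of_int (int (card T) - int m) \<cdot>\<^sub>v ?l) $ j"
    using q j dim by simp
qed (use A in \<open>simp add: class_sums_def\<close>)

lemma of_nat_ratfun2_nonzero: "k > 0 \<Longrightarrow> of_nat k \<noteq> (0::ratfun2)"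
  by (metis of_nat_eq_0_iff rf_const_hom.hom_of_nat rf_const_hom.hom_0_iff less_irrefl)

lemma mat_powi_class_sums:
  fixes z :: ratfun2 and m :: nat
  assumes q: "q > 0" and pc: "perfect_coloring q n r C S"
    and T: "T \<subseteq> {1..n}" and u: "u \<in> cube q n"
  defines "M \<equiv> mat_powi z (h_mat q n S - of_nat m \<cdot>\<^sub>m 1\<^sub>m r)"
  shows "M \<in> carrier_mat r r"
    and "M\<^sup>T *\<^sub>v class_sums q n r C T u = (z powi (int (card T) - int m)) \<cdot>\<^sub>v class_sums q n r C T u"
proof -
  define A where "A = h_mat q n S - of_nat m \<cdot>\<^sub>m 1\<^sub>m r"
  have S: "S \<in> carrier_mat r r" using pc by (simp add: perfect_coloring_def)
  then have A: "A \<in> carrier_mat r r" by (auto simp: A_def h_mat_def)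
  have ent: "of_nat q * A $$ (i, j) =
      of_bool (i = j) * ((of_nat q - 1) * of_nat n - of_nat q * of_nat m) - of_nat (S $$ (i, j))"
    if "i < r" "j < r" for i j
    using that S q by (auto simp: A_def h_mat_def field_simps)
  have ent': "of_nat q * map_mat rf_const A $$ (i, j) =
      of_bool (i = j) * ((of_nat q - 1) * of_nat n - of_nat q * of_nat m) - of_nat (S $$ (i, j))"
    if "i < r" "j < r" for i j
    using arg_cong[OF ent[OF that], of rf_const] that A
    by (auto simp: rf_const_hom.hom_mult rf_const_hom.hom_minus rf_const_hom.hom_of_nat)
  have q': "of_nat q \<noteq> (0::ratfun2)"
    using q by (rule of_nat_ratfun2_nonzero)
  \<comment> \<open>Diagonalizability is required over \<open>complex\<close>, so these class sums
    are complex; those in the conclusion live over \<open>ratfun2\<close>, where \<open>ent'\<close>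
    supplies the eigenvector equation.\<close>
  let ?L = "{class_sums q n r C T u | T u. T \<subseteq> {1..n} \<and> u \<in> cube q n} :: complex vec set"
  have "\<exists>P Q a. similar_mat_wit A (mat_diag r (\<lambda>i. of_int (a i))) P Q"
  proof (rule diagonalizable_of_separating_left_eigenvectors[OF A])
    show "?L \<subseteq> carrier_vec r" by (auto simp: class_sums_def)
    show "\<exists>k. A\<^sup>T *\<^sub>v l = of_int k \<cdot>\<^sub>v l" if lL: "l \<in> ?L" for l
    proof -
      obtain T u where l: "l = class_sums q n r C T u" and "T \<subseteq> {1..n}" "u \<in> cube q n"
        using lL by blast
      then have "A\<^sup>T *\<^sub>v l = of_int (int (card T) - int m) \<cdot>\<^sub>v l"
        unfolding l using q by (intro class_sums_left_eigenvector[OF _ pc A ent]) auto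
      then show ?thesis by (rule exI)
    qed
    show "x = 0\<^sub>v r" if "x \<in> carrier_vec r" "\<forall>l\<in>?L. l \<bullet> x = 0" for x
      using that(2) by (intro class_sums_separate[OF pc that(1)]) blast
  qed
  moreover have "dim_row A = r" using A by simp
  ultimately obtain N where N: "is_mat_powi z A N"
    unfolding is_mat_powi_def by metis
  then have MN: "M = N" unfolding M_def A_def[symmetric] by (rule mat_powi_eqI)
  obtain P Q a where PQ: "similar_mat_wit A (mat_diag r (\<lambda>i. of_int (a i))) P Q"
    and "N = map_mat rf_const P * mat_diag r (\<lambda>i. z powi a i) * map_mat rf_const Q"
    using N A unfolding is_mat_powi_def by auto
  then show "M \<in> carrier_mat r r"
    using similar_mat_witD2[OF A PQ] unfolding MN by auto
  have "map_mat rf_const A \<in> carrier_mat r r" using A by simp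
  from class_sums_left_eigenvector[OF q' pc this ent' T u]
  show "M\<^sup>T *\<^sub>v class_sums q n r C T u = (z powi (int (card T) - int m)) \<cdot>\<^sub>v class_sums q n r C T u"
    unfolding MN by (intro is_mat_powi_left_eigenvector[OF N A]) (simp_all add: class_sums_def)
qed

section \<open>The symmetric form of the product and the final identity\<close>

lemma local_weight_enum_row_times_mat_powi:
  assumes q: "q > 0" and pc: "perfect_coloring q n r C S"
    and \<alpha>: "\<alpha> \<in> cube q n" and J: "J \<subseteq> {1..n}"
    and z: "x + (of_nat q - 1) * y \<noteq> 0"
  shows "local_weight_enum_row q n r C J \<alpha> x y *
      mat_powi (x + (of_nat q - 1) * y) (h_mat q n S - of_nat (card J) \<cdot>\<^sub>m 1\<^sub>m r) =
    mat 1 r (\<lambda>(_, l). \<Sum>T\<in>Pow {1..n}. (x - y) ^ card (T \<inter> J) *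
      (x + (of_nat q - 1) * y) ^ card (T - J) * class_sums q n r C T \<alpha> $ l)"
proof -
  define z w where "z = x + (of_nat q - 1) * y" and "w = x - y"
  define M where "M = mat_powi z (h_mat q n S - of_nat (card J) \<cdot>\<^sub>m 1\<^sub>m r)"
  have q': "of_nat q \<noteq> (0::ratfun2)"
    using q by (rule of_nat_ratfun2_nonzero)
  let ?l = "\<lambda>T. class_sums q n r C T \<alpha>"
  have M: "M \<in> carrier_mat r r"
    unfolding M_def by (rule mat_powi_class_sums[OF q pc _ \<alpha>, of "{}"]) simp
  have eig: "(\<Sum>j<r. ?l T $ j * M $$ (j, l)) = z powi (int (card T) - int (card J)) * ?l T $ l"
    if "T \<subseteq> {1..n}" "l < r" for T l
  proof -
    have "(M\<^sup>T *\<^sub>v ?l T) $ l = (\<Sum>j<r. ?l T $ j * M $$ (j, l))"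
      using M that by (simp add: scalar_prod_def class_sums_def atLeast0LessThan mult.commute)
    then show ?thesis
      using mat_powi_class_sums(2)[OF q pc that(1) \<alpha>, of z "card J"] that
      by (simp add: M_def class_sums_def)
  qed
  \<comment> \<open>The common part \<open>card (T \<inter> J)\<close> cancels in the exponent. That
    exponent can be negative, which is where \<open>z\<close> must be nonzero.\<close>
  have powers: "z ^ card (J - T) * z powi (int (card T) - int (card J)) = z ^ card (T - J)"
    if "T \<subseteq> {1..n}" for T
  proof -
    have fin: "finite T" "finite J" using that J finite_subset by blast+
    have "card T = card (T \<inter> J) + card (T - J)" "card J = card (T \<inter> J) + card (J - T)"
      using card_Int_Diff[OF fin(1), of J] card_Int_Diff[OF fin(2), of T] by (simp_all add: Int_commute)
    then have "int (card (J - T)) + (int (card T) - int (card J)) = int (card (T - J))" by simp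
    then show ?thesis
      using z power_int_add[of z "int (card (J - T))" "int (card T) - int (card J)"]
      by (simp add: z_def)
  qed
  have "local_weight_enum_row q n r C J \<alpha> x y * M =
    mat 1 r (\<lambda>(_, l). \<Sum>T\<in>Pow {1..n}. w ^ card (T \<inter> J) * z ^ card (T - J) * ?l T $ l)"
  proof (rule eq_matI)
    fix i l
    assume "i < dim_row (mat 1 r (\<lambda>(_, l). \<Sum>T\<in>Pow {1..n}. w ^ card (T \<inter> J) * z ^ card (T - J) * ?l T $ l))"
      and "l < dim_col (mat 1 r (\<lambda>(_, l). \<Sum>T\<in>Pow {1..n}. w ^ card (T \<inter> J) * z ^ card (T - J) * ?l T $ l))"
    then have i: "i = 0" and l: "l < r" by auto
    have "(local_weight_enum_row q n r C J \<alpha> x y * M) $$ (0, l) =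
        (\<Sum>j<r. local_weight_enum q n (C j) J \<alpha> x y * M $$ (j, l))"
      using M l by (simp add: local_weight_enum_row_def scalar_prod_def atLeast0LessThan)
    also have "\<dots> = (\<Sum>j<r. \<Sum>T\<in>Pow {1..n}. w ^ card (T \<inter> J) * z ^ card (J - T) * (?l T $ j * M $$ (j, l)))"
      by (intro sum.cong refl)
        (simp add: local_weight_enum_eq_class_sums[OF q' pc J] sum_distrib_right z_def w_def mult.assoc)
    also have "\<dots> = (\<Sum>T\<in>Pow {1..n}. w ^ card (T \<inter> J) * z ^ card (J - T) * (\<Sum>j<r. ?l T $ j * M $$ (j, l)))"
      unfolding sum_distrib_left by (rule sum.swap)
    also have "\<dots> = (\<Sum>T\<in>Pow {1..n}. w ^ card (T \<inter> J) *
        (z ^ card (J - T) * z powi (int (card T) - int (card J))) * ?l T $ l)"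
      using eig l by (intro sum.cong refl) (simp add: mult.assoc)
    also have "\<dots> = (\<Sum>T\<in>Pow {1..n}. w ^ card (T \<inter> J) * z ^ card (T - J) * ?l T $ l)"
      using powers by (intro sum.cong refl) simp
    finally show "(local_weight_enum_row q n r C J \<alpha> x y * M) $$ (i, l) =
      mat 1 r (\<lambda>(_, l). \<Sum>T\<in>Pow {1..n}. w ^ card (T \<inter> J) * z ^ card (T - J) * ?l T $ l) $$ (i, l)"
      using i l by simp
  qed (use M in \<open>auto simp: local_weight_enum_row_def\<close>)
  then show ?thesis by (simp only: M_def z_def w_def)
qed

text \<open>As a polynomial in the second variable it has the nonzero constant coefficient
  \<open>[:0, 1:]\<close>. The cases \<open>c = q - 1\<close> and \<open>c = -1\<close> are the
  bases of the two matrix powers.\<close>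

lemma rf_X_plus_rf_Y_nonzero: "rf_X + rf_const c * rf_Y \<noteq> 0"
proof -
  have "rf_X + rf_const c * rf_Y = to_fract ([:[:0, 1:]:] + [:[:c:]:] * [:0, 1:])"
    unfolding rf_X_def rf_Y_def rf_const_def to_fract_add to_fract_mult ..
  also have "[:[:0, 1:]:] + [:[:c:]:] * [:0, 1:] = [:[:0, 1:], [:c:]:]"
    by simp
  finally show ?thesis by simp
qed

theorem theorem2:
  fixes q n r :: nat and C :: "nat \<Rightarrow> (nat \<Rightarrow> nat) set" and S :: "nat mat"
    and \<alpha> :: "nat \<Rightarrow> nat" and I I' :: "nat set" and x y x' y' :: ratfun2
  assumes "q \<ge> 2" and "n \<ge> 1"
    and "perfect_coloring q n r C S"
    and "\<alpha> \<in> cube q n"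
    and "I \<subseteq> {1..n}"
  defines "I' \<equiv> {1..n} - I"
    and "x \<equiv> rf_X" and "y \<equiv> rf_Y"
    and "x' \<equiv> x + (of_nat q - 2) * y" and "y' \<equiv> - y"
  shows "local_weight_enum_row q n r C I' \<alpha> x y *
           mat_powi (x + (of_nat q - 1) * y) (h_mat q n S - of_nat (card I') \<cdot>\<^sub>m 1\<^sub>m r) =
         local_weight_enum_row q n r C I \<alpha> x' y' *
           mat_powi (x' + (of_nat q - 1) * y') (h_mat q n S - of_nat (card I) \<cdot>\<^sub>m 1\<^sub>m r)"
proof -
  have q: "q > 0" using assms(1) by simp
  have swap: "x' + (of_nat q - 1) * y' = x - y" "x' - y' = x + (of_nat q - 1) * y"
    by (simp_all add: x'_def y'_def algebra_simps)
  have z: "x + (of_nat q - 1) * y \<noteq> 0"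
    using rf_X_plus_rf_Y_nonzero[of "of_nat q - 1"]
    by (simp add: x_def y_def rf_const_hom.hom_minus rf_const_hom.hom_of_nat)
  have w: "x' + (of_nat q - 1) * y' \<noteq> 0"
    using rf_X_plus_rf_Y_nonzero[of "-1"] unfolding swap
    by (simp add: x_def y_def rf_const_hom.hom_uminus)
  have I': "I' \<subseteq> {1..n}" by (auto simp: I'_def)
  have sets: "T \<inter> I' = T - I" "T - I' = T \<inter> I" if "T \<in> Pow {1..n}" for T
    using that by (auto simp: I'_def)
  have sums: "(\<Sum>T\<in>Pow {1..n}. (x - y) ^ card (T \<inter> I') * (x + (of_nat q - 1) * y) ^ card (T - I') *
        class_sums q n r C T \<alpha> $ l) =
      (\<Sum>T\<in>Pow {1..n}. (x' - y') ^ card (T \<inter> I) * (x' + (of_nat q - 1) * y') ^ card (T - I) *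
        class_sums q n r C T \<alpha> $ l)" for l
  proof (rule sum.cong[OF refl])
    fix T assume T: "T \<in> Pow {1..n}"
    show "(x - y) ^ card (T \<inter> I') * (x + (of_nat q - 1) * y) ^ card (T - I') *
        class_sums q n r C T \<alpha> $ l =
      (x' - y') ^ card (T \<inter> I) * (x' + (of_nat q - 1) * y') ^ card (T - I) *
        class_sums q n r C T \<alpha> $ l"
      unfolding swap sets[OF T] by (rule arg_cong2[OF mult.commute refl])
  qed
  show ?thesis
    unfolding local_weight_enum_row_times_mat_powi[OF q assms(3,4,5) w]
      local_weight_enum_row_times_mat_powi[OF q assms(3,4) I' z] sums ..
qed

end
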